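(* For every positive integer $n$, \[\sigma\overline{\mathrm{mex}}(n) \equiv \begin{cases} 1 \pmod 2, & \text{if } n=\tfrac{j(j+1)}{2} \text{ for some } j\in\mathbb{N},\\ 0 \pmod 2, & \text{otherwise.}\end{cases}\]
   Context: An overpartition of $n$ is a non-increasing sequence of positive integers summing to $n$ in which the first occurrence of each distinct part may be overlined. For an overpartition $\pi$, $\overline{\mathrm{mex}}(\pi)$ is the smallest positive integer that does not occur among the non-overlined parts of $\pi$. For a positive integer $n$, $\sigma\overline{\mathrm{mex}}(n)=\sum_{\pi}\overline{\mathrm{mex}}(\pi)$, the sum over all overpartitions $\pi$ of $n$. *)

theory Defs
  imports Main "HOL-Number_Theory.Cong"
begin

text \<open>
  A part is a pair (size, overlined). The last conjunct says that only the first
  occurrence of a given size may be overlined.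
\<close>

definition is_overpartition :: "nat \<Rightarrow> (nat \<times> bool) list \<Rightarrow> bool" where
  "is_overpartition n p \<longleftrightarrow>
     sorted_wrt (\<ge>) (map fst p) \<and>
     (\<forall>x \<in> set p. fst x > 0) \<and>
     sum_list (map fst p) = n \<and>
     (\<forall>i < length p. snd (p ! i) \<longrightarrow> (\<forall>k < i. fst (p ! k) \<noteq> fst (p ! i)))"

definition overpartitions :: "nat \<Rightarrow> (nat \<times> bool) list set" where
  "overpartitions n = {p. is_overpartition n p}"

definition overline_mex :: "(nat \<times> bool) list \<Rightarrow> nat" where
  "overline_mex p = (LEAST m. m > 0 \<and> (m, False) \<notin> set p)"

definition sigma_overline_mex :: "nat \<Rightarrow> nat" where
  "sigma_overline_mex n = (\<Sum>p \<in> overpartitions n. overline_mex p)"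

lemma finite_overpartitions: "finite (overpartitions n)"
proof -
  have len: "length p \<le> sum_list (map fst p)"
    if "\<forall>x \<in> set p. fst x > 0" for p :: "(nat \<times> bool) list"
    using that by (induction p) (auto simp: Suc_le_eq)
  have "overpartitions n \<subseteq> {p. set p \<subseteq> {..n} \<times> UNIV \<and> length p \<le> n}"
  proof
    fix p assume "p \<in> overpartitions n"
    hence p: "\<forall>x \<in> set p. fst x > 0" "sum_list (map fst p) = n"
      by (auto simp: overpartitions_def is_overpartition_def)
    have "fst x \<le> n" if "x \<in> set p" for x
      using member_le_sum_list[of "fst x" "map fst p"] that p by auto
    thus "p \<in> {p. set p \<subseteq> {..n} \<times> UNIV \<and> length p \<le> n}"
      using len[OF p(1)] p(2) by fastforce
  qed
  thus ?thesis
    by (rule finite_subset) (intro finite_lists_length_le finite_cartesian_product; simp)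
qed

text \<open>The set of admissible values in the definition of the mex is never empty.\<close>

lemma overline_mex_wf: "overline_mex p > 0 \<and> (overline_mex p, False) \<notin> set p"
proof -
  obtain m where "m \<notin> insert 0 (fst ` set p)"
    using ex_new_if_finite[of "insert 0 (fst ` set p)"] by auto
  hence "m > 0 \<and> (m, False) \<notin> set p" by force
  thus ?thesis unfolding overline_mex_def by (rule LeastI)
qed

end

theory Submission
  imports Defs "HOL-Library.Disjoint_Sets" "HOL-Library.Z2"
begin

text \<open>
  Summing over the values below the mex, \<open>sigma_overline_mex n\<close> is the sum over \<open>m\<close> of the number of
  overpartitions of \<open>n\<close> in which each of \<open>1, \<dots>, m\<close> occurs non-overlined. Call a part size free if it
  exceeds \<open>m\<close> or occurs at least twice. Flipping the overline on the first occurrence of the largest free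
  size is an involution without fixed points on those of these overpartitions that have a free size.
  The only one without a free size is \<open>m + \<dots> + 2 + 1\<close>, so the \<open>m\<close>-th summand
  is odd exactly when \<open>n = m (m + 1) / 2\<close>.
\<close>

lemma even_card_involution:
  assumes "\<And>x. x \<in> A \<Longrightarrow> f x \<in> A" "\<And>x. x \<in> A \<Longrightarrow> f (f x) = x"
    "\<And>x. x \<in> A \<Longrightarrow> f x \<noteq> x"
  shows "even (card A)"
proof -
  \<comment> \<open>In \<open>bit\<close> we have 1 + 1 = 0, so the terms of \<open>x\<close> and
    \<open>f x\<close> cancel; the sum is the cardinality modulo 2.\<close>
  have "(\<Sum>x\<in>A. 1 :: bit) = 0"
    using assms by (intro sum_involution_eq_0[where h = f]) simp_all
  hence "even (of_nat (card A) :: bit)" by simp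
  thus ?thesis by (simp only: even_of_nat_iff)
qed

fun toggle :: "nat \<Rightarrow> (nat \<times> bool) list \<Rightarrow> (nat \<times> bool) list" where
  "toggle s [] = []"
| "toggle s ((x, b) # p) = (if x = s then (x, \<not> b) # p else (x, b) # toggle s p)"

lemma map_fst_toggle [simp]: "map fst (toggle s p) = map fst p"
  by (induction s p rule: toggle.induct) auto

lemma toggle_toggle [simp]: "toggle s (toggle s p) = p"
  by (induction s p rule: toggle.induct) auto

lemma toggle_neq: "s \<in> set (map fst p) \<Longrightarrow> toggle s p \<noteq> p"
  by (induction s p rule: toggle.induct) auto

lemma mem_toggle_iff: "k \<noteq> s \<Longrightarrow> (k, b) \<in> set (toggle s p) \<longleftrightarrow> (k, b) \<in> set p"
  by (induction s p rule: toggle.induct) auto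

text \<open>The index condition of \<open>is_overpartition\<close> recast as a pairwise relation,
  which unfolds along the list and so suits induction.\<close>

definition first_overlined :: "(nat \<times> bool) list \<Rightarrow> bool" where
  "first_overlined = sorted_wrt (\<lambda>x y. fst x = fst y \<longrightarrow> \<not> snd y)"

lemma is_overpartition_iff:
  "is_overpartition n p \<longleftrightarrow>
     sorted_wrt (\<ge>) (map fst p) \<and> 0 \<notin> set (map fst p) \<and> sum_list (map fst p) = n \<and> first_overlined p"
proof -
  have "(\<forall>i < length p. snd (p ! i) \<longrightarrow> (\<forall>k < i. fst (p ! k) \<noteq> fst (p ! i))) \<longleftrightarrow> first_overlined p"
    unfolding first_overlined_def sorted_wrt_iff_nth_less by blast
  moreover have "(\<forall>x \<in> set p. fst x > 0) \<longleftrightarrow> 0 \<notin> set (map fst p)"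
    by force
  ultimately show ?thesis
    unfolding is_overpartition_def by blast
qed

text \<open>In a pair of entries of equal size only the later one is constrained, and the toggled
  entry is the first of its size.\<close>

lemma first_overlined_toggle: "first_overlined p \<Longrightarrow> first_overlined (toggle s p)"
  unfolding first_overlined_def
  by (induction s p rule: toggle.induct) (auto simp: mem_toggle_iff)

text \<open>Any occurrence of \<open>s\<close> after the first is non-overlined, and
  \<open>toggle\<close> leaves it alone.\<close>

lemma toggle_mem_repeated:
  assumes "first_overlined p" "count_list (map fst p) s \<ge> 2"
  shows "(s, False) \<in> set (toggle s p)"
  using assms unfolding first_overlined_def
proof (induction s p rule: toggle.induct)
  case (2 s x b p)
  show ?case
  proof (cases "x = s")
    case True
    with 2(3) have "count_list (map fst p) s \<noteq> 0" by simp
    hence "s \<in> set (map fst p)" unfolding count_list_0_iff by simp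
    with 2(2) True show ?thesis by force
  qed (use 2 in auto)
qed simp

lemma less_overline_mex_iff: "m < overline_mex p \<longleftrightarrow> (\<forall>k\<in>{1..m}. (k, False) \<in> set p)"
proof
  assume m: "m < overline_mex p"
  show "\<forall>k\<in>{1..m}. (k, False) \<in> set p"
  proof
    fix k assume "k \<in> {1..m}"
    with m not_less_Least[of k "\<lambda>m. m > 0 \<and> (m, False) \<notin> set p"]
    show "(k, False) \<in> set p" unfolding overline_mex_def by simp
  qed
next
  assume "\<forall>k\<in>{1..m}. (k, False) \<in> set p"
  thus "m < overline_mex p"
    using overline_mex_wf[of p] by (metis One_nat_def Suc_leI atLeastAtMost_iff not_less)
qed

text \<open>This depends on the list of sizes only, which \<open>toggle\<close> preserves. Hence the
  largest free size is the same before and after toggling, which makes the map an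
  involution.\<close>

definition free_sizes :: "nat \<Rightarrow> nat list \<Rightarrow> nat set" where
  "free_sizes m xs = {s \<in> set xs. m < s \<or> count_list xs s \<ge> 2}"

lemma distinct_iff_count_list: "distinct xs \<longleftrightarrow> (\<forall>x. count_list xs x < 2)"
proof (induction xs)
  case (Cons a xs)
  have "(\<forall>x. count_list (a # xs) x < 2) \<longleftrightarrow> count_list xs a = 0 \<and> (\<forall>x. count_list xs x < 2)"
    by (auto simp: less_Suc_eq numeral_2_eq_2)
  thus ?case using Cons.IH by (simp add: count_list_0_iff)
qed simp

definition staircase :: "nat \<Rightarrow> (nat \<times> bool) list" where
  "staircase m = map (\<lambda>k. (k, False)) (rev [1..<Suc m])"

lemma map_fst_staircase: "map fst (staircase m) = rev [1..<Suc m]"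
  by (simp add: staircase_def comp_def del: upt_Suc)

lemma sum_list_staircase: "sum_list (map fst (staircase m)) = m * (m + 1) div 2"
  unfolding map_fst_staircase by (induction m) auto

lemma staircase_overpartition:
  "staircase m \<in> overpartitions (m * (m + 1) div 2)" "m < overline_mex (staircase m)"
  "free_sizes m (map fst (staircase m)) = {}"
proof -
  have "first_overlined (staircase m)"
    unfolding first_overlined_def sorted_wrt_iff_nth_less staircase_def
    by (auto simp del: upt_Suc)
  moreover have "sorted_wrt (\<ge>) (rev [1..<Suc m])"
    by (simp add: sorted_wrt_rev del: upt_Suc)
  ultimately show "staircase m \<in> overpartitions (m * (m + 1) div 2)"
    using sum_list_staircase[of m] unfolding overpartitions_def is_overpartition_iff
    by (simp add: map_fst_staircase del: upt_Suc set_map)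
  show "m < overline_mex (staircase m)"
    unfolding less_overline_mex_iff by (auto simp: staircase_def simp del: upt_Suc)
  show "free_sizes m (map fst (staircase m)) = {}"
    using distinct_iff_count_list[of "[1..<Suc m]"] unfolding free_sizes_def map_fst_staircase
    by (auto simp: not_le simp del: upt_Suc)
qed

text \<open>Without a free size, all sizes are distinct and at most \<open>m\<close>, while the mex
  condition forces each of 1, ..., \<open>m\<close> to occur. The ordering then fixes the list of
  sizes.\<close>

lemma staircase_unique:
  assumes "p \<in> overpartitions n" "m < overline_mex p" "free_sizes m (map fst p) = {}"
  shows "p = staircase m"
proof -
  let ?xs = "map fst p"
  have p: "sorted_wrt (\<ge>) ?xs" "0 \<notin> set ?xs"
    using assms(1) by (simp_all add: overpartitions_def is_overpartition_iff)
  have mem: "(k, False) \<in> set p" if "k \<in> {1..m}" for k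
    using assms(2) that unfolding less_overline_mex_iff by blast
  have free: "s \<le> m \<and> count_list ?xs s < 2" if "s \<in> set ?xs" for s
    using assms(3) that unfolding free_sizes_def by force
  have dist: "distinct ?xs"
    unfolding distinct_iff_count_list using free count_notin[of _ ?xs] by (metis zero_less_numeral)
  have set_xs: "set ?xs = {1..m}"
  proof
    show "set ?xs \<subseteq> {1..m}" using free p(2) by (metis atLeastAtMost_iff less_one not_less subsetI)
    show "{1..m} \<subseteq> set ?xs" using mem by force
  qed
  have "rev ?xs = [1..<Suc m]"
  proof (rule sorted_distinct_set_unique)
    show "sorted (rev ?xs)" using p(1) by (simp only: sorted_wrt_rev)
  qed (use dist set_xs in \<open>auto simp del: upt_Suc\<close>)
  hence xs: "?xs = rev [1..<Suc m]" by (metis rev_rev_ident)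
  \<comment> \<open>Each size belongs to a single entry, so that entry must be the non-overlined one
    supplied by the mex condition.\<close>
  have "(fst x, False) = x" if "x \<in> set p" for x
  proof -
    have "(fst x, False) \<in> set p" using mem set_xs that by fastforce
    thus ?thesis using eq_key_imp_eq_value[OF dist, of "fst x" False "snd x"] that
      by (metis prod.collapse)
  qed
  hence "p = map (\<lambda>k. (k, False)) ?xs" by (simp add: map_idI comp_def)
  thus ?thesis unfolding staircase_def by (simp only: xs)
qed

lemma odd_card_mex_greater_iff:
  "odd (card {p \<in> overpartitions n. m < overline_mex p}) \<longleftrightarrow> n = m * (m + 1) div 2"
proof -
  let ?B = "{p \<in> overpartitions n. m < overline_mex p}"
  let ?F = "\<lambda>p. free_sizes m (map fst p)"
  let ?G = "{p \<in> ?B. ?F p \<noteq> {}}" and ?H = "{p \<in> ?B. ?F p = {}}"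
  let ?t = "\<lambda>p. toggle (Max (?F p)) p"
  have fin: "finite ?B" using finite_overpartitions by simp
  have Max_F: "Max (?F p) \<in> ?F p" if "p \<in> ?G" for p
    using that by (intro Max_in) (auto simp: free_sizes_def)
  have "even (card ?G)"
  proof (rule even_card_involution[where f = ?t])
    fix p assume G: "p \<in> ?G"
    show "?t p \<noteq> p"
      using Max_F[OF G] by (intro toggle_neq) (simp add: free_sizes_def)
    show "?t (?t p) = p" by simp
    have op: "is_overpartition n p" using G by (simp add: overpartitions_def)
    have "m < overline_mex (?t p)"
      unfolding less_overline_mex_iff
    proof
      fix k assume k: "k \<in> {1..m}"
      have kp: "(k, False) \<in> set p" using G k unfolding less_overline_mex_iff by blast
      show "(k, False) \<in> set (?t p)"
      \<comment> \<open>Only the toggled size could lose its non-overlined copy. If it is at most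
        \<open>m\<close>, being free means that it is repeated, so a later copy survives.\<close>
      proof (cases "k = Max (?F p)")
        case True
        hence "count_list (map fst p) k \<ge> 2" using Max_F[OF G] k by (simp add: free_sizes_def)
        thus ?thesis using toggle_mem_repeated op True by (simp add: is_overpartition_iff)
      qed (use kp in \<open>simp add: mem_toggle_iff\<close>)
    qed
    moreover have "is_overpartition n (?t p)"
      using op first_overlined_toggle by (simp add: is_overpartition_iff del: set_map)
    ultimately show "?t p \<in> ?G" using G by (simp add: overpartitions_def)
  qed
  moreover have "card ?H = (if n = m * (m + 1) div 2 then 1 else 0)"
  proof -
    have H_iff: "p \<in> ?H \<longleftrightarrow> p = staircase m \<and> n = m * (m + 1) div 2" for p
    proof
      assume H: "p \<in> ?H"
      hence "p = staircase m" using staircase_unique by blast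
      moreover from H have "sum_list (map fst p) = n"
        by (simp add: overpartitions_def is_overpartition_iff)
      ultimately show "p = staircase m \<and> n = m * (m + 1) div 2"
        using sum_list_staircase by blast
    qed (use staircase_overpartition in blast)
    show ?thesis
    proof (cases "n = m * (m + 1) div 2")
      case True
      hence "?H = {staircase m}" using H_iff by blast
      moreover have "card {staircase m} = 1" by simp
      ultimately show ?thesis using True by (simp only: simp_thms if_True)
    next
      case False
      hence "?H = {}" using H_iff by blast
      thus ?thesis using False by (simp only: card.empty if_False)
    qed
  qed
  moreover have "card ?B = card ?G + card ?H"
  proof -
    have "?B = ?G \<union> ?H" by blast
    hence "card ?B = card (?G \<union> ?H)" by (rule arg_cong)
    also have "\<dots> = card ?G + card ?H"
    proof (rule card_Un_disjoint)
      show "finite ?G" "finite ?H" by (rule rev_finite_subset[OF fin], blast)+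
      show "?G \<inter> ?H = {}" by blast
    qed
    finally show ?thesis .
  qed
  moreover have "odd (a + (if P then 1 else 0)) \<longleftrightarrow> P" if "even a" for a :: nat and P
    using that by simp
  ultimately show ?thesis by (simp only:)
qed

text \<open>Consecutive values differ by \<open>n + 1\<close>. This ensures that at most one summand
  of the layered sum is odd.\<close>

lemma inj_triangular: "inj (\<lambda>j::nat. j * (j + 1) div 2)"
proof (rule strict_mono_imp_inj_on, unfold strict_mono_Suc_iff, rule allI)
  show "n * (n + 1) div 2 < Suc n * (Suc n + 1) div 2" for n :: nat
    by (simp add: algebra_simps)
qed

text \<open>Each mex is the number of \<open>m\<close> below it; the bound \<open>N\<close> keeps
  all of these in range, and the two sums are exchanged.\<close>

lemma sigma_overline_mex_eq_sum:
  assumes "\<And>p. p \<in> overpartitions n \<Longrightarrow> overline_mex p \<le> N"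
  shows "sigma_overline_mex n = (\<Sum>m<N. card {p \<in> overpartitions n. m < overline_mex p})"
proof -
  have "sigma_overline_mex n = (\<Sum>p\<in>overpartitions n. \<Sum>m<N. if m < overline_mex p then 1 else 0)"
    unfolding sigma_overline_mex_def
  proof (rule sum.cong[OF refl])
    fix p assume "p \<in> overpartitions n"
    hence "{m \<in> {..<N}. m < overline_mex p} = {..<overline_mex p}" using assms by fastforce
    thus "overline_mex p = (\<Sum>m<N. if m < overline_mex p then 1 else 0)"
      by (simp flip: sum.inter_filter)
  qed
  also have "\<dots> = (\<Sum>m<N. \<Sum>p\<in>overpartitions n. if m < overline_mex p then 1 else 0)"
    by (rule sum.swap)
  finally show ?thesis by (simp add: finite_overpartitions flip: sum.inter_filter)
qed

theorem theorem1p3: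
  fixes n :: nat
  assumes "n > 0"
  shows "[sigma_overline_mex n =
           (if \<exists>j::nat. n = j * (j + 1) div 2 then 1 else 0)] (mod 2)"
proof -
  \<comment> \<open>\<open>N\<close> has to bound every mex, and each is at most the sum of all of
    them. It also has to exceed any \<open>j\<close> whose triangular number is \<open>n\<close>;
    such a \<open>j\<close> is at most \<open>n\<close>.\<close>
  define N where "N = Suc (n + sigma_overline_mex n)"
  let ?J = "{m \<in> {..<N}. n = m * (m + 1) div 2}"
  have "overline_mex p \<le> sigma_overline_mex n" if "p \<in> overpartitions n" for p
    unfolding sigma_overline_mex_def
    using that by (intro member_le_sum) (auto simp: finite_overpartitions)
  hence "overline_mex p \<le> N" if "p \<in> overpartitions n" for p
    using that unfolding N_def by fastforce
  from sigma_overline_mex_eq_sum[OF this]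
  \<comment> \<open>A sum has the parity of the number of its odd summands, and \<open>?J\<close>
    collects the indices of these.\<close>
  have odd_iff: "odd (sigma_overline_mex n) \<longleftrightarrow> odd (card ?J)"
    by (simp add: even_sum_iff odd_card_mex_greater_iff)
  have le: "m \<le> m * (m + 1) div 2" for m :: nat by (cases m) auto
  have "card ?J = (if \<exists>j. n = j * (j + 1) div 2 then 1 else 0)"
  proof (cases "\<exists>j. n = j * (j + 1) div 2")
    case True
    then obtain j where j: "n = j * (j + 1) div 2" by blast
    have "?J = {j}"
      using injD[OF inj_triangular, of _ j] le[of j] j unfolding N_def by fastforce
    with True show ?thesis by simp
  qed auto
  thus ?thesis using odd_iff by (auto simp: cong_def odd_iff_mod_2_eq_one)
qed

end
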